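(* Let $\beta>0$, let $V_0$ be an admissible initial condition, and suppose that $(V(t,x),L_t)$ is a classical solution of (FBP$_\beta$) with initial condition $V_0$. For $t>0$, let $$U(t,x):=\frac2\beta e^{-\frac2\beta x}\int_{-\infty}^xe^{\frac2\beta z}V(t,z)\,dz\qquad\forall x\in\mathbb R.$$ Then $(U(t,x),L_t)$ is a classical solution of (FBP) with initial condition $U_0$ given by $$U_0(x)=\frac2\beta e^{-\frac2\beta x}\int_{-\infty}^xe^{\frac2\beta z}V_0(z)\,dz\qquad\forall x\in\mathbb R.$$
   Context: Admissible initial condition: a càdlàg non-increasing function $W_0:\mathbb R\to[0,1]$ with $W_0(x)\to 1$ as $x\to-\infty$ and $W_0(x)\to 0$ as $x\to\infty$. (FBP): $\partial_t U=\frac12\Delta U+U$ for $t>0$, $x>L_t$; $U(t,x)=1$ for $t>0$, $x\le L_t$; $\partial_xU(t,L_t)=0$ for $t>0$; $U(t,\cdot)\to U_0(\cdot)$ in $L^1_{\mathrm{loc}}$ as $t\to0$. A classical solution of (FBP) is a pair $(U(t,x),L_t)$ such that: (i) $L_t\in\mathbb R$ for all $t>0$ and $t\mapsto L_t$ is continuous on $(0,\infty)$; (ii) $U:(0,\infty)\times\mathbb R\to[0,1]$ with $U\in C^{1,2}(\{(t,x):t>0,x>L_t\})\cap C((0,\infty)\times\mathbb R)$; (iii) $(U,L)$ satisfies (FBP). (FBP$_\beta$): $\partial_tV=\frac12\Delta V+V$ for $t>0$, $x>L_t$; $V(t,x)=1$ for $t>0$, $x\le L_t$; $\partial_xV(t,L_t+)=-\beta$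 for $t>0$; $V(t,\cdot)\to V_0(\cdot)$ in $L^1_{\mathrm{loc}}$ as $t\to0$. A classical solution of (FBP$_\beta$) is a pair $(V(t,x),L_t)$ such that: (i) $L_t\in\mathbb R$ for all $t>0$ and $t\mapsto L_t$ is continuous on $(0,\infty)$; (ii) $V:(0,\infty)\times\mathbb R\to[0,1]$ with $V\in C^{1,2}(\{(t,x):t>0,x>L_t\})\cap C((0,\infty)\times\mathbb R)$; (iii) $\partial_xV(t_n,x_n)\to-\beta$ as $n\to\infty$ for any $t>0$ and any sequence $(t_n,x_n)\to(t,L_t)$ with $x_n>L_{t_n}$ for all $n$; (iv) $(V,L)$ satisfies (FBP$_\beta$). *)

theory Defs
  imports "HOL-Analysis.Analysis"
begin

definition cadlag :: "(real \<Rightarrow> real) \<Rightarrow> bool" where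
  "cadlag f \<longleftrightarrow>
     (\<forall>x. (f \<longlongrightarrow> f x) (at_right x)) \<and> (\<forall>x. \<exists>l. (f \<longlongrightarrow> l) (at_left x))"

definition admissible :: "(real \<Rightarrow> real) \<Rightarrow> bool" where
  "admissible W0 \<longleftrightarrow>
     cadlag W0 \<and> antimono W0 \<and> range W0 \<subseteq> {0..1} \<and>
     (W0 \<longlongrightarrow> 1) at_bot \<and> (W0 \<longlongrightarrow> 0) at_top"

text \<open>
  Functions of time and space are curried, time first. The value \<open>deriv f x\<close> is only
  meaningful where \<open>f\<close> is differentiable; \<open>C12_on\<close> below supplies this.
\<close>

definition D_t :: "(real \<Rightarrow> real \<Rightarrow> real) \<Rightarrow> real \<Rightarrow> real \<Rightarrow> real" where
  "D_t u t x = deriv (\<lambda>s. u s x) t"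

definition D_x :: "(real \<Rightarrow> real \<Rightarrow> real) \<Rightarrow> real \<Rightarrow> real \<Rightarrow> real" where
  "D_x u t x = deriv (\<lambda>y. u t y) x"

definition D_xx :: "(real \<Rightarrow> real \<Rightarrow> real) \<Rightarrow> real \<Rightarrow> real \<Rightarrow> real" where
  "D_xx u t x = D_x (D_x u) t x"

text \<open>
  Here \<open>D\<close> is meant to be open, since the derivatives are two-sided. All
  continuity is joint in time and space.
\<close>

definition C12_on :: "(real \<times> real) set \<Rightarrow> (real \<Rightarrow> real \<Rightarrow> real) \<Rightarrow> bool" where
  "C12_on D u \<longleftrightarrow>
     (\<forall>(t, x) \<in> D. (\<lambda>s. u s x) differentiable (at t) \<and>
                   (\<lambda>y. u t y) differentiable (at x) \<and>
                   (\<lambda>y. D_x u t y) differentiable (at x)) \<and>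
     continuous_on D (\<lambda>(t, x). u t x) \<and>
     continuous_on D (\<lambda>(t, x). D_t u t x) \<and>
     continuous_on D (\<lambda>(t, x). D_x u t x) \<and>
     continuous_on D (\<lambda>(t, x). D_xx u t x)"

text \<open>
  Convergence in \<open>L\<^sup>1\<^sub>l\<^sub>o\<^sub>c\<close> as \<open>t\<close> decreases to 0. The integrability clauses are
  needed because the Bochner integral of a non-integrable function is 0 by convention.
\<close>

definition L1_loc_initial :: "(real \<Rightarrow> real \<Rightarrow> real) \<Rightarrow> (real \<Rightarrow> real) \<Rightarrow> bool" where
  "L1_loc_initial u u0 \<longleftrightarrow>
     (\<forall>K. compact K \<longrightarrow>
        set_integrable lborel K u0 \<and>
        (\<forall>t>0. set_integrable lborel K (u t)) \<and>
        ((\<lambda>t. LINT x:K|lborel. \<bar>u t x - u0 x\<bar>) \<longlongrightarrow> 0) (at_right 0))"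

definition FBP :: "(real \<Rightarrow> real) \<Rightarrow> (real \<Rightarrow> real \<Rightarrow> real) \<Rightarrow> (real \<Rightarrow> real) \<Rightarrow> bool" where
  "FBP U0 U L \<longleftrightarrow>
     (\<forall>t>0. \<forall>x>L t. D_t U t x = 1/2 * D_xx U t x + U t x) \<and>
     (\<forall>t>0. \<forall>x\<le>L t. U t x = 1) \<and>
     (\<forall>t>0. ((\<lambda>x. U t x) has_real_derivative 0) (at (L t))) \<and>
     L1_loc_initial U U0"

text \<open>
  The boundary slope at \<open>L t +\<close> is the limit from the right of the spatial derivative.
\<close>

definition FBP_beta ::
  "real \<Rightarrow> (real \<Rightarrow> real) \<Rightarrow> (real \<Rightarrow> real \<Rightarrow> real) \<Rightarrow> (real \<Rightarrow> real) \<Rightarrow> bool" where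
  "FBP_beta \<beta> V0 V L \<longleftrightarrow>
     (\<forall>t>0. \<forall>x>L t. D_t V t x = 1/2 * D_xx V t x + V t x) \<and>
     (\<forall>t>0. \<forall>x\<le>L t. V t x = 1) \<and>
     (\<forall>t>0. ((\<lambda>x. D_x V t x) \<longlongrightarrow> - \<beta>) (at_right (L t))) \<and>
     L1_loc_initial V V0"

definition regular_pair :: "(real \<Rightarrow> real \<Rightarrow> real) \<Rightarrow> (real \<Rightarrow> real) \<Rightarrow> bool" where
  "regular_pair u L \<longleftrightarrow>
     continuous_on {0<..} L \<and>
     (\<forall>t>0. \<forall>x. u t x \<in> {0..1}) \<and>
     C12_on {(t, x). t > 0 \<and> x > L t} u \<and>
     continuous_on ({0<..} \<times> UNIV) (\<lambda>(t, x). u t x)"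

definition classical_solution_FBP ::
  "(real \<Rightarrow> real) \<Rightarrow> (real \<Rightarrow> real \<Rightarrow> real) \<Rightarrow> (real \<Rightarrow> real) \<Rightarrow> bool" where
  "classical_solution_FBP U0 U L \<longleftrightarrow> regular_pair U L \<and> FBP U0 U L"

definition classical_solution_FBP_beta ::
  "real \<Rightarrow> (real \<Rightarrow> real) \<Rightarrow> (real \<Rightarrow> real \<Rightarrow> real) \<Rightarrow> (real \<Rightarrow> real) \<Rightarrow> bool" where
  "classical_solution_FBP_beta \<beta> V0 V L \<longleftrightarrow>
     regular_pair V L \<and>
     (\<forall>t>0. \<forall>(tn :: nat \<Rightarrow> real) (xn :: nat \<Rightarrow> real).
        tn \<longlonglongrightarrow> t \<and> xn \<longlonglongrightarrow> L t \<and> (\<forall>n. tn n > 0 \<and> xn n > L (tn n))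
        \<longrightarrow> (\<lambda>n. D_x V (tn n) (xn n)) \<longlonglongrightarrow> - \<beta>) \<and>
     FBP_beta \<beta> V0 V L"

end

theory Submission
  imports Defs
begin

text \<open>
  Put \<open>a = 2 / \<beta>\<close>. Since \<open>U t x\<close> is the average of \<open>z \<mapsto> V t (x + z)\<close> against the probability density
  \<open>a * exp (a * z)\<close> on the negative half line, bounds, joint continuity and the initial condition pass
  from \<open>V\<close> to \<open>U\<close>. In space, \<open>U\<^sub>x = a (V - U)\<close>, which vanishes at \<open>L t\<close>. The point is the time derivative
  of \<open>I t x = \<integral>\<^bsub>-\<infinity>\<^esub>\<^bsup>x\<^esup> exp (a z) V t z dz\<close>, because \<open>L\<close> need not be differentiable. Near the boundary \<open>V t\<close>
  has slope close to \<open>-\<beta>\<close>, so \<open>V t z = 1 - \<epsilon>\<close> has a unique solution \<open>z = l\<^sub>\<epsilon> t\<close> there, and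
  \<open>\<integral> exp (a z) (V t z - (1 - \<epsilon>)) dz\<close> over \<open>l\<^sub>\<epsilon> t \<le> z \<le> x\<close> has time derivative \<open>\<integral> exp (a z) V\<^sub>t dz\<close> over the same
  interval. The equation and an integration by parts turn this into boundary terms and a multiple of
  \<open>I\<close>; as \<open>\<epsilon> \<longrightarrow> 0\<close> the terms at \<open>L t\<close> cancel precisely because \<open>a * \<beta> = 2\<close>.
\<close>

section \<open>Exponential averages\<close>

definition exp_kernel :: "real \<Rightarrow> real \<Rightarrow> real" where
  "exp_kernel a z = indicator {..0} z * (a * exp (a * z))"

text \<open>Leaving out the factor \<open>a * exp (- a * x)\<close> gives the simple space
  derivative \<open>exp (a * x) * f x\<close> and makes differences between two end points plain
  integrals.\<close>

definition exp_primitive :: "real \<Rightarrow> (real \<Rightarrow> real) \<Rightarrow> real \<Rightarrow> real" where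
  "exp_primitive a f x = (LINT z:{..x}|lborel. exp (a * z) * f z)"

lemma exp_kernel_measurable [measurable]: "exp_kernel a \<in> borel_measurable borel"
  unfolding exp_kernel_def by measurable

lemma exp_kernel_nonneg: "a > 0 \<Longrightarrow> 0 \<le> exp_kernel a z"
  by (simp add: exp_kernel_def)

text \<open>Reflection at 0 reduces the claim to the half line \<open>{0..}\<close>, where the
  primitive \<open>- exp (- (a * z))\<close> yields total mass 1.\<close>

lemma has_bochner_integral_exp_kernel:
  assumes "a > 0"
  shows "has_bochner_integral lborel (exp_kernel a) 1"
proof -
  have "(\<integral>\<^sup>+z. ennreal (a * exp (- (a * z))) * indicator {0..} z \<partial>lborel) = 0 - (- exp (- (a * 0)))"
  proof (rule nn_integral_FTC_atLeast)
    show "((\<lambda>z. - exp (- (a * z))) has_real_derivative a * exp (- (a * z))) (at z)" for z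
      by (auto intro!: derivative_eq_intros)
    have "filterlim (\<lambda>z. - (a * z)) at_bot at_top"
      using assms unfolding filterlim_uminus_at_bot
      by (simp add: filterlim_tendsto_pos_mult_at_top[OF tendsto_const] filterlim_ident)
    then show "((\<lambda>z. - exp (- (a * z))) \<longlongrightarrow> 0) at_top"
      using tendsto_minus[OF filterlim_compose[OF exp_at_bot]] by force
  qed (use assms in auto)
  then have "(\<integral>\<^sup>+z. ennreal (indicator {0..} z * (a * exp (- (a * z)))) \<partial>lborel) = ennreal 1"
    by (simp add: indicator_def of_bool_def if_distrib if_distribR cong: if_cong)
  then have "has_bochner_integral lborel (\<lambda>z. indicator {0..} z * (a * exp (- (a * z)))) 1"
    using assms by (intro has_bochner_integral_nn_integral) (auto simp: indicator_def)
  then have "has_bochner_integral lborel (\<lambda>z. indicator {0..} (0 + -1 * z) * (a * exp (- (a * (0 + -1 * z))))) 1"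
    by (subst (asm) lborel_has_bochner_integral_real_affine_iff[where c = "-1" and t = 0]) auto
  then show ?thesis
    unfolding exp_kernel_def[abs_def] by (simp add: indicator_def of_bool_def cong: if_cong)
qed

lemma integrable_exp_kernel_mult:
  assumes a: "a > 0" and [measurable]: "f \<in> borel_measurable borel" and bd: "\<And>z. \<bar>f z\<bar> \<le> B"
  shows "integrable lborel (\<lambda>z. exp_kernel a z * f z)"
proof (rule Bochner_Integration.integrable_bound)
  show "integrable lborel (\<lambda>z. exp_kernel a z * B)"
    using has_bochner_integral_exp_kernel[OF a] by (simp add: has_bochner_integral_iff)
  show "AE z in lborel. norm (exp_kernel a z * f z) \<le> norm (exp_kernel a z * B)"
  proof (rule AE_I2)
    fix z
    have "\<bar>f z\<bar> \<le> \<bar>B\<bar>" using bd[of z] by linarith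
    then show "norm (exp_kernel a z * f z) \<le> norm (exp_kernel a z * B)"
      by (simp add: abs_mult mult_left_mono)
  qed
qed measurable

text \<open>The redundant factors \<open>1 *\<close> are those produced by the affine substitution
  with scale 1 and shift \<open>x\<close>, so that the equation rewrites its output
  directly.\<close>

lemma exp_primitive_integrand_shift:
  fixes a x z :: real
  shows "indicator {..x} (x + 1 * z) *\<^sub>R (exp (a * (x + 1 * z)) * f (x + 1 * z))
    = exp (a * x) * (indicator {..0} z * exp (a * z) * f (x + z))"
  by (cases "z \<le> 0") (simp_all add: distrib_left exp_add)

text \<open>Translation by \<open>x\<close> turns the primitive into an explicit factor times an
  average against a fixed probability density; bounds and limits are read off from this
  form.\<close>

lemma exp_primitive_eq:
  assumes "a > 0"
  shows "exp_primitive a f x = exp (a * x) / a * (LINT z|lborel. exp_kernel a z * f (x + z))"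
proof -
  have "exp_primitive a f x
      = (LINT z|lborel. indicator {..x} (x + 1 * z) *\<^sub>R (exp (a * (x + 1 * z)) * f (x + 1 * z)))"
    unfolding exp_primitive_def set_lebesgue_integral_def
    by (subst lborel_integral_real_affine[where c = 1 and t = x]) simp_all
  also have "\<dots> = (LINT z|lborel. exp (a * x) / a * (exp_kernel a z * f (x + z)))"
    unfolding exp_primitive_integrand_shift exp_kernel_def using assms by (simp add: mult_ac)
  finally show ?thesis by simp
qed

lemma exp_primitive_integrable:
  fixes a x B :: real
  assumes a: "a > 0" and [measurable]: "f \<in> borel_measurable borel" and bd: "\<And>z. \<bar>f z\<bar> \<le> B"
  shows "set_integrable lborel {..x} (\<lambda>z. exp (a * z) * f z)"
proof -
  have "integrable lborel (\<lambda>z. exp_kernel a z * f (x + z))"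
    by (rule integrable_exp_kernel_mult[OF a _ bd]) measurable
  then have "integrable lborel (\<lambda>z. exp (a * x) / a * (exp_kernel a z * f (x + z)))"
    by simp
  also have "(\<lambda>z. exp (a * x) / a * (exp_kernel a z * f (x + z)))
      = (\<lambda>z. indicator {..x} (x + 1 * z) *\<^sub>R (exp (a * (x + 1 * z)) * f (x + 1 * z)))"
    unfolding exp_primitive_integrand_shift exp_kernel_def using a by (simp add: mult_ac)
  finally show ?thesis
    unfolding set_integrable_def by (subst (asm) lborel_integrable_real_affine_iff) auto
qed

lemma exp_primitive_const_one: "a > 0 \<Longrightarrow> exp_primitive a (\<lambda>_. 1) x = exp (a * x) / a"
  using exp_primitive_eq[of a "\<lambda>_. 1" x] has_bochner_integral_exp_kernel[of a]
  by (simp add: has_bochner_integral_iff)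

lemma exp_primitive_cong: "(\<And>z. z \<le> x \<Longrightarrow> f z = g z) \<Longrightarrow> exp_primitive a f x = exp_primitive a g x"
  unfolding exp_primitive_def by (rule set_lebesgue_integral_cong) auto

text \<open>Passage from the Lebesgue to the gauge integral, to which the fundamental theorem and
  the Leibniz rule are applied later; the end point \<open>b\<close> is negligible.\<close>

lemma exp_primitive_diff:
  assumes a: "a > 0" and [measurable]: "f \<in> borel_measurable borel" and bd: "\<And>z. \<bar>f z\<bar> \<le> B"
    and "b \<le> x"
  shows "exp_primitive a f x - exp_primitive a f b = integral {b..x} (\<lambda>z. exp (a * z) * f z)"
proof -
  let ?g = "\<lambda>z. exp (a * z) * f z"
  note int = exp_primitive_integrable[OF assms(1-3)]
  have "{..x} = {..b} \<union> {b<..x}"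
    using \<open>b \<le> x\<close> by auto
  then have "exp_primitive a f x = (LINT z:{..b} \<union> {b<..x}|lborel. ?g z)"
    unfolding exp_primitive_def by simp
  also have "\<dots> = exp_primitive a f b + (LINT z:{b<..x}|lborel. ?g z)"
    unfolding exp_primitive_def
    by (rule set_integral_Un) (auto intro: int set_integrable_subset[OF int[of x]])
  also have "(LINT z:{b<..x}|lborel. ?g z) = integral {b<..x} ?g"
    by (rule set_borel_integral_eq_integral) (auto intro: set_integrable_subset[OF int[of x]])
  also have "\<dots> = integral {b..x} ?g"
    by (rule integral_subset_negligible)
       (auto intro: negligible_subset[OF negligible_sing[of b]])
  finally show ?thesis by simp
qed

lemma exp_primitive_has_derivative:
  assumes a: "a > 0" and cont: "continuous_on UNIV f" and bd: "\<And>z. \<bar>f z\<bar> \<le> B"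
  shows "(exp_primitive a f has_real_derivative exp (a * x) * f x) (at x)"
proof -
  have m: "f \<in> borel_measurable borel"
    using cont by (rule borel_measurable_continuous_onI)
  have c: "continuous_on S (\<lambda>z. exp (a * z) * f z)" for S
    by (rule continuous_on_subset[OF _ subset_UNIV]) (intro continuous_intros cont)
  \<comment> \<open>The base point \<open>x - 1\<close> only serves to make \<open>x\<close>
    interior to a compact interval; the part of the primitive below it is constant.\<close>
  have "((\<lambda>y. integral {x - 1..y} (\<lambda>z. exp (a * z) * f z)) has_real_derivative exp (a * x) * f x)
      (at x within {x - 1..x + 1})"
    by (rule integral_has_real_derivative[OF c]) auto
  then have "((\<lambda>y. integral {x - 1..y} (\<lambda>z. exp (a * z) * f z)) has_real_derivative exp (a * x) * f x) (at x)"
    by (subst (asm) at_within_Icc_at) auto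
  then have "((\<lambda>y. exp_primitive a f (x - 1) + integral {x - 1..y} (\<lambda>z. exp (a * z) * f z))
      has_real_derivative exp (a * x) * f x) (at x)"
    by (auto intro!: derivative_eq_intros)
  then show ?thesis
    by (rule has_field_derivative_transform_within_open[where S = "{x - 1<..}"])
       (auto simp: exp_primitive_diff[OF a m bd, symmetric])
qed

section \<open>Bounds and joint continuity of the averages\<close>

lemma integral_exp_kernel_bounds:
  assumes a: "a > 0" and [measurable]: "f \<in> borel_measurable borel" and bd: "\<And>z. f z \<in> {0..1}"
  shows "(LINT z|lborel. exp_kernel a z * f (x + z)) \<in> {0..1}"
proof -
  have "(LINT z|lborel. exp_kernel a z * f (x + z)) \<le> (LINT z|lborel. exp_kernel a z)"
    using a bd has_bochner_integral_exp_kernel[OF a]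
    by (intro integral_mono integrable_exp_kernel_mult[where B = 1])
       (auto simp: has_bochner_integral_iff exp_kernel_nonneg mult_left_le)
  moreover have "0 \<le> (LINT z|lborel. exp_kernel a z * f (x + z))"
    using a bd by (intro Bochner_Integration.integral_nonneg) (auto simp: exp_kernel_nonneg)
  ultimately show ?thesis
    using has_bochner_integral_exp_kernel[OF a] by (simp add: has_bochner_integral_iff)
qed

text \<open>Dominated convergence along sequences in \<open>(t, x)\<close>: since \<open>V\<close>
  takes values in the unit interval, the kernel itself is a majorant.\<close>

lemma continuous_on_exp_primitive:
  fixes V :: "real \<Rightarrow> real \<Rightarrow> real"
  assumes a: "a > 0" and cont: "continuous_on ({0<..} \<times> UNIV) (\<lambda>(t, x). V t x)"
    and bd: "\<And>t x. t > 0 \<Longrightarrow> V t x \<in> {0..1}"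
  shows "continuous_on ({0<..} \<times> UNIV) (\<lambda>(t, x). exp_primitive a (V t) x)"
proof -
  have m: "V t \<in> borel_measurable borel" if "t > 0" for t
  proof (rule borel_measurable_continuous_onI)
    show "continuous_on UNIV (V t)"
      using continuous_on_compose2[OF cont, of UNIV "Pair t"] that
      by (force intro: continuous_intros)
  qed
  have "continuous_on ({0<..} \<times> UNIV) (\<lambda>p. LINT z|lborel. exp_kernel a z * V (fst p) (snd p + z))"
  proof (rule continuous_on_sequentiallyI)
    fix q :: "nat \<Rightarrow> real \<times> real" and p :: "real \<times> real"
    assume q: "\<forall>n. q n \<in> {0<..} \<times> UNIV" and p: "p \<in> {0<..} \<times> UNIV" and lim: "q \<longlonglongrightarrow> p"
    have pos: "fst p > 0" "\<And>n. fst (q n) > 0"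
      using p q by (auto simp: mem_Times_iff)
    show "(\<lambda>n. LINT z|lborel. exp_kernel a z * V (fst (q n)) (snd (q n) + z))
        \<longlonglongrightarrow> (LINT z|lborel. exp_kernel a z * V (fst p) (snd p + z))"
    proof (rule integral_dominated_convergence[where w = "exp_kernel a"])
      show "integrable lborel (exp_kernel a)"
        using has_bochner_integral_exp_kernel[OF a] by (simp add: has_bochner_integral_iff)
      show "AE z in lborel. (\<lambda>n. exp_kernel a z * V (fst (q n)) (snd (q n) + z))
          \<longlonglongrightarrow> exp_kernel a z * V (fst p) (snd p + z)"
      proof (rule AE_I2, rule tendsto_mult_left)
        fix z
        have "(\<lambda>n. (fst (q n), snd (q n) + z)) \<longlonglongrightarrow> (fst p, snd p + z)"
          by (intro tendsto_intros lim)
        with continuous_on_tendsto_compose[OF cont this] pos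
        show "(\<lambda>n. V (fst (q n)) (snd (q n) + z)) \<longlonglongrightarrow> V (fst p) (snd p + z)"
          by simp
      qed
      show "AE z in lborel. norm (exp_kernel a z * V (fst (q n)) (snd (q n) + z)) \<le> exp_kernel a z" for n
        using bd[OF pos(2)[of n]] exp_kernel_nonneg[OF a]
        by (intro AE_I2) (auto simp: abs_mult mult_left_le)
      show "(\<lambda>z. exp_kernel a z * V (fst p) (snd p + z)) \<in> borel_measurable lborel"
        using m[OF pos(1)] by measurable
      show "(\<lambda>z. exp_kernel a z * V (fst (q n)) (snd (q n) + z)) \<in> borel_measurable lborel" for n
        using m[OF pos(2)[of n]] by measurable
    qed
  qed
  moreover have "continuous_on ({0<..} \<times> UNIV) (\<lambda>p. exp (a * snd p) / a)"
    using a by (intro continuous_intros) auto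
  ultimately have "continuous_on ({0<..} \<times> UNIV)
      (\<lambda>p. exp (a * snd p) / a * (LINT z|lborel. exp_kernel a z * V (fst p) (snd p + z)))"
    by (rule continuous_on_mult[rotated])
  then show ?thesis
    unfolding exp_primitive_eq[OF a] case_prod_unfold .
qed

section \<open>The initial condition under averaging\<close>

lemma set_integrable_bounded_compact:
  fixes f :: "real \<Rightarrow> real"
  assumes K: "compact K" and [measurable]: "f \<in> borel_measurable borel" and bd: "\<And>z. \<bar>f z\<bar> \<le> B"
  shows "set_integrable lborel K f"
proof -
  have [measurable]: "K \<in> sets borel"
    using K by (rule borel_compact)
  have "integrable lborel (\<lambda>x. indicator K x *\<^sub>R B)"
    using borel_integrable_compact[OF K, of "\<lambda>_. B"] by (simp add: indicator_def if_distrib)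
  then show ?thesis
    unfolding set_integrable_def
  proof (rule Bochner_Integration.integrable_bound)
    have "\<bar>f x\<bar> \<le> \<bar>B\<bar>" for x using bd[of x] by linarith
    then show "AE x in lborel. norm (indicator K x *\<^sub>R f x) \<le> norm (indicator K x *\<^sub>R B)"
      by (intro AE_I2) (simp add: indicator_def)
  qed measurable
qed

lemma abs_le_one_unit_interval: "(x :: real) \<in> {0..1} \<Longrightarrow> \<bar>x\<bar> \<le> 1"
  by auto

text \<open>By Fubini, the distance of the averages on \<open>K\<close> is at most the average over
  \<open>z\<close> of \<open>H t z\<close>, the distance of \<open>V t\<close> and \<open>V0\<close>
  on the translate of \<open>K\<close> by \<open>z\<close>. Each \<open>H t z\<close> tends to 0 by
  hypothesis and is at most the measure of \<open>K\<close>, so dominated convergence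
  applies.\<close>

lemma L1_loc_initial_exp_kernel:
  fixes V U :: "real \<Rightarrow> real \<Rightarrow> real"
  assumes a: "a > 0"
    and V: "\<And>t. t > 0 \<Longrightarrow> V t \<in> borel_measurable borel" "\<And>t x. t > 0 \<Longrightarrow> V t x \<in> {0..1}"
    and V0 [measurable]: "V0 \<in> borel_measurable borel" and V0_bd: "\<And>x. V0 x \<in> {0..1}"
    and init: "L1_loc_initial V V0"
    and U: "\<And>t x. t > 0 \<Longrightarrow> U t x = (LINT z|lborel. exp_kernel a z * V t (x + z))"
    and U0: "\<And>x. U0 x = (LINT z|lborel. exp_kernel a z * V0 (x + z))"
  shows "L1_loc_initial U U0"
  unfolding L1_loc_initial_def
proof (intro allI impI conjI)
  fix K :: "real set" assume K: "compact K"
  then have [measurable]: "K \<in> sets borel"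
    by (rule borel_compact)
  have finK: "integrable lborel (indicator K :: real \<Rightarrow> real)"
    using set_integrable_bounded_compact[OF K, of "\<lambda>_. 1" 1] by (simp add: set_integrable_def)
  have mU: "U t \<in> borel_measurable borel" if "t > 0" for t
  proof -
    note [measurable] = V(1)[OF that]
    have "(\<lambda>x. LINT z|lborel. exp_kernel a z * V t (x + z)) \<in> borel_measurable borel"
      by measurable
    then show ?thesis
      by (subst measurable_cong[OF U[OF that]])
  qed
  have "(\<lambda>x. LINT z|lborel. exp_kernel a z * V0 (x + z)) \<in> borel_measurable borel"
    by measurable
  then have mU0 [measurable]: "U0 \<in> borel_measurable borel"
    by (subst measurable_cong[OF U0])
  have bU: "U t x \<in> {0..1}" if "t > 0" for t x
    unfolding U[OF that] using V that by (intro integral_exp_kernel_bounds[OF a])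
  have bU0: "U0 x \<in> {0..1}" for x
    unfolding U0 using V0 V0_bd by (intro integral_exp_kernel_bounds[OF a])
  show "set_integrable lborel K U0"
    by (intro set_integrable_bounded_compact[where B = 1] K mU0 abs_le_one_unit_interval bU0)
  show "set_integrable lborel K (U t)" if "t > 0" for t
    by (intro set_integrable_bounded_compact[where B = 1] K mU abs_le_one_unit_interval bU that)

  define w where "w t y = \<bar>V t y - V0 y\<bar>" for t y
  define H where "H t z = (LINT x|lborel. indicator K x * w t (x + z))" for t z
  have w: "0 \<le> w t y" "w t y \<le> 1" if "t > 0" for t y
    using V(2)[OF that, of y] V0_bd[of y] by (auto simp: w_def abs_if)
  have mw: "w t \<in> borel_measurable borel" if "t > 0" for t
    unfolding w_def using V(1)[OF that] by measurable
  have w_int: "integrable lborel (\<lambda>x. indicator K x * w t (x + z))" if "t > 0" for t z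
  proof -
    have "set_integrable lborel K (\<lambda>x. w t (x + z))"
      using mw[OF that] w[OF that] by (intro set_integrable_bounded_compact[where B = 1] K) auto
    then show ?thesis
      by (simp add: set_integrable_def)
  qed
  have H_bd: "0 \<le> H t z" "H t z \<le> measure lborel K" if "t > 0" for t z
  proof -
    show "0 \<le> H t z"
      unfolding H_def using w(1)[OF that] by (intro Bochner_Integration.integral_nonneg) auto
    have "H t z \<le> (LINT x|lborel. indicator K x)"
      unfolding H_def using w[OF that] by (intro integral_mono w_int that finK) (auto simp: indicator_def)
    then show "H t z \<le> measure lborel K"
      by simp
  qed
  have H_lim: "((\<lambda>t. H t z) \<longlongrightarrow> 0) (at_right 0)" for z
  proof -
    have "compact ((+) z ` K)"
      using K by (rule compact_translation)
    then have "((\<lambda>t. LINT y:(+) z ` K|lborel. \<bar>V t y - V0 y\<bar>) \<longlongrightarrow> 0) (at_right 0)"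
      using init unfolding L1_loc_initial_def by blast
    moreover have "(LINT y:(+) z ` K|lborel. \<bar>V t y - V0 y\<bar>) = H t z" for t
      unfolding H_def set_lebesgue_integral_def w_def
      by (subst lborel_integral_real_affine[where c = 1 and t = z])
         (auto simp: indicator_def add.commute image_iff intro!: Bochner_Integration.integral_cong)
    ultimately show ?thesis by simp
  qed
  have dist_le: "(LINT x:K|lborel. \<bar>U t x - U0 x\<bar>) \<le> (LINT z|lborel. exp_kernel a z * H t z)"
    if t: "t > 0" for t
  proof -
    note [measurable] = V(1)[OF t] mw[OF t] mU[OF t]
    have k: "integrable lborel (exp_kernel a)"
      using has_bochner_integral_exp_kernel[OF a] by (simp add: has_bochner_integral_iff)
    \<comment> \<open>The majorant is a product of two functions of one variable each; this settles
      the joint integrability on which the exchange of the integrals rests.\<close>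
    have prod: "integrable (lborel \<Otimes>\<^sub>M lborel) (\<lambda>(z, x). exp_kernel a z * (indicator K x * w t (x + z)))"
    proof (rule Bochner_Integration.integrable_bound)
      show "integrable (lborel \<Otimes>\<^sub>M lborel) (\<lambda>p. exp_kernel a (fst p) * (indicator K (snd p) :: real))"
      proof (rule lborel_pair.Fubini_integrable)
        show "integrable lborel (\<lambda>x. LINT y|lborel. norm (exp_kernel a (fst (x, y)) * (indicator K (snd (x, y)) :: real)))"
          using k exp_kernel_nonneg[OF a] by (simp add: abs_mult)
        show "AE x in lborel. integrable lborel (\<lambda>y. exp_kernel a (fst (x, y)) * (indicator K (snd (x, y)) :: real))"
          using finK by simp
      qed measurable
      show "AE p in lborel \<Otimes>\<^sub>M lborel. norm (case p of (z, x) \<Rightarrow> exp_kernel a z * (indicator K x * w t (x + z)))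
          \<le> norm (exp_kernel a (fst p) * (indicator K (snd p) :: real))"
        using w[OF t] by (intro AE_I2) (auto simp: abs_mult indicator_def mult_left_le split: prod.split)
    qed measurable
    have pw: "indicator K x * \<bar>U t x - U0 x\<bar> \<le> (LINT z|lborel. exp_kernel a z * (indicator K x * w t (x + z)))" for x
    proof -
      have i1: "integrable lborel (\<lambda>z. exp_kernel a z * V t (x + z))"
        by (rule integrable_exp_kernel_mult[OF a, where B = 1]) (measurable, intro abs_le_one_unit_interval V(2) t)
      have i2: "integrable lborel (\<lambda>z. exp_kernel a z * V0 (x + z))"
        by (rule integrable_exp_kernel_mult[OF a, where B = 1]) (measurable, intro abs_le_one_unit_interval V0_bd)
      have "\<bar>U t x - U0 x\<bar> = \<bar>LINT z|lborel. exp_kernel a z * V t (x + z) - exp_kernel a z * V0 (x + z)\<bar>"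
        unfolding U[OF t] U0 using i1 i2 by simp
      also have "\<dots> \<le> (LINT z|lborel. \<bar>exp_kernel a z * V t (x + z) - exp_kernel a z * V0 (x + z)\<bar>)"
        by (rule integral_abs_bound)
      also have "\<dots> = (LINT z|lborel. exp_kernel a z * w t (x + z))"
        unfolding w_def right_diff_distrib[symmetric] abs_mult by (simp only: abs_of_nonneg[OF exp_kernel_nonneg[OF a]])
      finally show ?thesis
        by (simp add: indicator_def)
    qed
    have "(LINT x:K|lborel. \<bar>U t x - U0 x\<bar>) = (LINT x|lborel. indicator K x * \<bar>U t x - U0 x\<bar>)"
      by (simp add: set_lebesgue_integral_def)
    also have "\<dots> \<le> (LINT x|lborel. LINT z|lborel. exp_kernel a z * (indicator K x * w t (x + z)))"
    proof (rule integral_mono)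
      have "set_integrable lborel K (\<lambda>x. \<bar>U t x - U0 x\<bar>)"
      proof (rule set_integrable_bounded_compact[where B = 1])
        show "\<bar>\<bar>U t x - U0 x\<bar>\<bar> \<le> 1" for x
          using bU[OF t, of x] bU0[of x] by (auto simp: abs_if)
      qed (use K in measurable)
      then show "integrable lborel (\<lambda>x. indicator K x * \<bar>U t x - U0 x\<bar>)"
        by (simp add: set_integrable_def)
      show "integrable lborel (\<lambda>x. LINT z|lborel. exp_kernel a z * (indicator K x * w t (x + z)))"
        using lborel_pair.integrable_snd[OF prod] .
    qed (rule pw)
    also have "\<dots> = (LINT z|lborel. LINT x|lborel. exp_kernel a z * (indicator K x * w t (x + z)))"
      using prod by (rule lborel_pair.Fubini_integral)
    also have "\<dots> = (LINT z|lborel. exp_kernel a z * H t z)"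
      by (simp add: H_def)
    finally show ?thesis .
  qed
  \<comment> \<open>The limit is taken along sequences in order to apply dominated convergence, and
    0 is written as an integral to match its conclusion.\<close>
  have "((\<lambda>t. LINT z|lborel. exp_kernel a z * H t z) \<longlongrightarrow> integral\<^sup>L lborel (\<lambda>_ :: real. 0)) (at_right 0)"
    unfolding tendsto_at_iff_sequentially comp_def
  proof (intro allI impI)
    fix s :: "nat \<Rightarrow> real" assume s: "\<forall>i. s i \<in> {0<..} - {0}" "s \<longlonglongrightarrow> 0"
    then have pos: "s i > 0" for i by auto
    show "(\<lambda>i. LINT z|lborel. exp_kernel a z * H (s i) z) \<longlonglongrightarrow> integral\<^sup>L lborel (\<lambda>_ :: real. 0)"
    proof (rule integral_dominated_convergence[where w = "\<lambda>z. exp_kernel a z * measure lborel K"])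
      show "integrable lborel (\<lambda>z. exp_kernel a z * measure lborel K)"
        using has_bochner_integral_exp_kernel[OF a] by (simp add: has_bochner_integral_iff)
      show "AE z in lborel. (\<lambda>i. exp_kernel a z * H (s i) z) \<longlonglongrightarrow> 0"
      proof (rule AE_I2)
        fix z
        have "(\<lambda>i. H (s i) z) \<longlonglongrightarrow> 0"
          using H_lim[of z] s unfolding tendsto_at_iff_sequentially comp_def by blast
        from tendsto_mult_right_zero[OF this] show "(\<lambda>i. exp_kernel a z * H (s i) z) \<longlonglongrightarrow> 0" .
      qed
      show "AE z in lborel. norm (exp_kernel a z * H (s i) z) \<le> exp_kernel a z * measure lborel K" for i
        using H_bd[OF pos[of i]] exp_kernel_nonneg[OF a]
        by (intro AE_I2) (auto simp: abs_mult intro: mult_left_mono)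
      show "(\<lambda>z. exp_kernel a z * H (s i) z) \<in> borel_measurable lborel" for i
        unfolding H_def using mw[OF pos[of i]] by measurable
    qed simp
  qed
  then have lim: "((\<lambda>t. LINT z|lborel. exp_kernel a z * H t z) \<longlongrightarrow> 0) (at_right 0)"
    by simp
  show "((\<lambda>t. LINT x:K|lborel. \<bar>U t x - U0 x\<bar>) \<longlongrightarrow> 0) (at_right 0)"
  proof (rule real_tendsto_sandwich[OF _ _ tendsto_const lim])
    show "\<forall>\<^sub>F t in at_right 0. 0 \<le> (LINT x:K|lborel. \<bar>U t x - U0 x\<bar>)"
      unfolding set_lebesgue_integral_def by (intro always_eventually allI Bochner_Integration.integral_nonneg) simp
    show "\<forall>\<^sub>F t in at_right 0. (LINT x:K|lborel. \<bar>U t x - U0 x\<bar>) \<le> (LINT z|lborel. exp_kernel a z * H t z)"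
      using dist_le by (auto simp: eventually_at_right_less intro: eventually_mono[OF eventually_at_right_less])
  qed
qed

section \<open>Time derivative of the exponential primitive\<close>

text \<open>The quotient \<open>(q s - q t)\<^sup>2 / (s - t)\<close> is \<open>q s - q t\<close>,
  which tends to 0, times a convergent difference quotient. Later \<open>r\<close> is the effect of
  moving an end point of integration.\<close>

lemma has_real_derivative_zero_if_quadratic_bound:
  fixes q r :: "real \<Rightarrow> real"
  assumes q: "(q has_real_derivative d) (at t)" and "r t = 0"
    and bound: "\<forall>\<^sub>F s in at t. \<bar>r s\<bar> \<le> C * (q s - q t)\<^sup>2"
  shows "(r has_real_derivative 0) (at t)"
proof -
  have "((\<lambda>s. q s - q t) \<longlongrightarrow> 0) (at t)"
    using DERIV_isCont[OF q] by (simp add: isCont_def LIM_zero)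
  moreover have "((\<lambda>s. \<bar>(q s - q t) / (s - t)\<bar>) \<longlongrightarrow> \<bar>d\<bar>) (at t)"
    using q unfolding has_field_derivative_iff by (rule tendsto_rabs)
  ultimately have "((\<lambda>s. C * (\<bar>q s - q t\<bar> * \<bar>(q s - q t) / (s - t)\<bar>)) \<longlongrightarrow> C * (\<bar>0\<bar> * \<bar>d\<bar>)) (at t)"
    by (intro tendsto_mult tendsto_const tendsto_rabs[of "\<lambda>s. q s - q t"])
  then have lim: "((\<lambda>s. C * (\<bar>q s - q t\<bar> * \<bar>(q s - q t) / (s - t)\<bar>)) \<longlongrightarrow> 0) (at t)"
    by simp
  show ?thesis
    unfolding has_field_derivative_iff
  proof (rule Lim_null_comparison[OF _ lim])
    show "\<forall>\<^sub>F s in at t. norm ((r s - r t) / (s - t)) \<le> C * (\<bar>q s - q t\<bar> * \<bar>(q s - q t) / (s - t)\<bar>)"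
      using bound
    proof eventually_elim
      case (elim s)
      then have "\<bar>r s\<bar> / \<bar>s - t\<bar> \<le> C * (q s - q t)\<^sup>2 / \<bar>s - t\<bar>"
        by (rule divide_right_mono) simp
      then show ?case
        using \<open>r t = 0\<close> by (simp add: power2_eq_square flip: abs_mult)
    qed
  qed
qed

section \<open>The function \<open>V\<close>, its free boundary and their regularity\<close>

text \<open>Only the evolution at positive times is collected here; the initial condition is treated
  separately. The parameter \<open>a\<close> stands for \<open>2 / \<beta>\<close>, and
  \<open>a_beta\<close> is the relation that makes the boundary terms cancel.\<close>

locale fbp_beta =
  fixes a \<beta> :: real and V :: "real \<Rightarrow> real \<Rightarrow> real" and L :: "real \<Rightarrow> real"
  assumes a_pos: "a > 0" and beta_pos: "\<beta> > 0" and a_beta: "a * \<beta> = 2"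
    and regular: "regular_pair V L"
    and V_left: "\<And>t x. t > 0 \<Longrightarrow> x \<le> L t \<Longrightarrow> V t x = 1"
    and pde: "\<And>t x. t > 0 \<Longrightarrow> x > L t \<Longrightarrow> D_t V t x = 1/2 * D_xx V t x + V t x"
    and slope: "\<And>t tn xn. t > 0 \<Longrightarrow> tn \<longlonglongrightarrow> t \<Longrightarrow> xn \<longlonglongrightarrow> L t \<Longrightarrow> (\<And>n :: nat. tn n > 0 \<and> xn n > L (tn n))
        \<Longrightarrow> (\<lambda>n. D_x V (tn n) (xn n)) \<longlonglongrightarrow> - \<beta>"
begin

definition D :: "(real \<times> real) set" where "D = {(t, x). t > 0 \<and> x > L t}"

abbreviation I :: "real \<Rightarrow> real \<Rightarrow> real" where "I t x \<equiv> exp_primitive a (V t) x"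

text \<open>Boundary term of two integrations by parts, that is, a space primitive of
  \<open>exp (a * x) * (D_xx V t x / 2 - a\<^sup>2 / 2 * V t x)\<close>.\<close>

definition flux :: "real \<Rightarrow> real \<Rightarrow> real" where
  "flux t x = exp (a * x) * (D_x V t x / 2 - a / 2 * V t x)"

lemma D_iff: "(t, x) \<in> D \<longleftrightarrow> t > 0 \<and> x > L t"
  by (simp add: D_def)

lemma L_cont: "continuous_on {0<..} L"
  using regular by (simp add: regular_pair_def)

lemma L_isCont: "t > 0 \<Longrightarrow> isCont L t"
  using L_cont by (simp add: continuous_on_eq_continuous_at)

lemma V_bounds: "t > 0 \<Longrightarrow> V t x \<in> {0..1}"
  using regular unfolding regular_pair_def by blast

lemma V_abs: "t > 0 \<Longrightarrow> \<bar>V t x\<bar> \<le> 1"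
  using V_bounds[of t x] by simp

lemma V_cont: "continuous_on ({0<..} \<times> UNIV) (\<lambda>(t, x). V t x)"
  using regular by (simp add: regular_pair_def)

lemma open_half_plane: "open ({0<..} \<times> UNIV :: (real \<times> real) set)"
  by (intro open_Times) auto

lemma V_tendsto:
  assumes "t > 0" "(f \<longlongrightarrow> t) F" "(g \<longlongrightarrow> x) F"
  shows "((\<lambda>n. V (f n) (g n)) \<longlongrightarrow> V t x) F"
proof -
  have "isCont (\<lambda>(t, x). V t x) (t, x)"
    using V_cont open_half_plane assms(1) by (simp add: continuous_on_eq_continuous_at)
  from isCont_tendsto_compose[OF this tendsto_Pair[OF assms(2,3)]] show ?thesis
    by simp
qed

lemma V_cont_x: "t > 0 \<Longrightarrow> continuous_on S (V t)"
  unfolding continuous_on_def using V_tendsto[OF _ tendsto_const tendsto_ident_at] by blast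

lemma V_measurable: "t > 0 \<Longrightarrow> V t \<in> borel_measurable borel"
  by (intro borel_measurable_continuous_onI V_cont_x)

lemma open_D: "open D"
proof -
  have "continuous_on ({0<..} \<times> UNIV) (\<lambda>p. snd p - L (fst p))"
    by (intro continuous_intros continuous_on_compose2[OF L_cont]) auto
  from continuous_open_preimage[OF this open_half_plane, of "{0<..}"]
  have "open (({0<..} \<times> UNIV) \<inter> (\<lambda>p. snd p - L (fst p)) -` {0<..})"
    by simp
  also have "({0<..} \<times> UNIV) \<inter> (\<lambda>p. snd p - L (fst p)) -` {0<..} = D"
    by (auto simp: D_def)
  finally show ?thesis .
qed

lemma C12: "C12_on D V"
  using regular by (simp add: regular_pair_def D_def)

lemma V_derivs:
  assumes "(t, x) \<in> D"
  shows "((\<lambda>s. V s x) has_real_derivative D_t V t x) (at t)"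
    and "(V t has_real_derivative D_x V t x) (at x)"
    and "(D_x V t has_real_derivative D_xx V t x) (at x)"
proof -
  have "(\<lambda>s. V s x) differentiable (at t)" "(\<lambda>y. V t y) differentiable (at x)"
      "(\<lambda>y. D_x V t y) differentiable (at x)"
    using C12 assms unfolding C12_on_def by blast+
  then show "((\<lambda>s. V s x) has_real_derivative D_t V t x) (at t)"
    and "(V t has_real_derivative D_x V t x) (at x)"
    and "(D_x V t has_real_derivative D_xx V t x) (at x)"
    unfolding D_t_def D_xx_def D_x_def
    by (simp_all add: DERIV_deriv_iff_real_differentiable)
qed

lemma V_deriv_conts:
  "continuous_on D (\<lambda>(t, x). D_t V t x)" "continuous_on D (\<lambda>(t, x). D_x V t x)"
  using C12 by (auto simp: C12_on_def)

lemma flux_deriv: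
  assumes "(t, x) \<in> D"
  shows "(flux t has_real_derivative exp (a * x) * (D_xx V t x / 2 - a\<^sup>2 / 2 * V t x)) (at x)"
  unfolding flux_def
  by (auto intro!: derivative_eq_intros V_derivs assms simp: field_simps power2_eq_square)

lemma I_cont: "continuous_on ({0<..} \<times> UNIV) (\<lambda>(t, x). I t x)"
  by (intro continuous_on_exp_primitive a_pos V_cont V_bounds)

lemma I_tendsto:
  assumes "t > 0" "(f \<longlongrightarrow> t) F" "(g \<longlongrightarrow> x) F"
  shows "((\<lambda>n. I (f n) (g n)) \<longlongrightarrow> I t x) F"
proof -
  have "isCont (\<lambda>(t, x). I t x) (t, x)"
    using I_cont open_half_plane assms(1) by (simp add: continuous_on_eq_continuous_at)
  from isCont_tendsto_compose[OF this tendsto_Pair[OF assms(2,3)]] show ?thesis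
    by simp
qed

lemma I_deriv_x: "t > 0 \<Longrightarrow> (I t has_real_derivative exp (a * x) * V t x) (at x)"
  by (rule exp_primitive_has_derivative[where B = 1]) (auto intro: a_pos V_cont_x V_abs)

lemma I_left: "t > 0 \<Longrightarrow> x \<le> L t \<Longrightarrow> I t x = exp (a * x) / a"
  using exp_primitive_cong[of x "V t" "\<lambda>_. 1" a] V_left[of t] exp_primitive_const_one[OF a_pos]
  by simp

section \<open>Time derivative over an interval inside the domain\<close>

text \<open>With \<open>b\<close> fixed inside the domain, differentiation under the integral is
  allowed. By the equation, \<open>exp (a * z) * D_t V t z\<close> is the space derivative of
  \<open>flux\<close> plus \<open>(a\<^sup>2 / 2 + 1) * exp (a * z) * V t z\<close>.\<close>

lemma interior_time_derivative:
  assumes t: "t > 0" and b: "L t < b" "b \<le> x"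
  shows "((\<lambda>s. I s x - I s b) has_real_derivative
      flux t x - flux t b + (a\<^sup>2 / 2 + 1) * (I t x - I t b)) (at t)"
proof -
  have "\<forall>\<^sub>F s in at t. s > 0 \<and> L s < b"
    by (intro eventually_conj order_tendstoD(1)[OF tendsto_ident_at t]
          order_tendstoD(2)[OF L_isCont[OF t, unfolded isCont_def] b(1)])
  then obtain e where e: "e > 0" "\<And>s. s \<noteq> t \<Longrightarrow> dist s t < e \<Longrightarrow> s > 0 \<and> L s < b"
    unfolding eventually_at by auto
  \<comment> \<open>Half the radius makes \<open>S\<close> a closed interval inside the
    neighbourhood, so that \<open>S \<times> {b..x}\<close> lies in \<open>D\<close>.\<close>
  define S where "S = {t - e / 2..t + e / 2}"
  have S: "s > 0" "L s < b" if "s \<in> S" for s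
    using e(2)[of s] that t b \<open>e > 0\<close> by (cases "s = t"; force simp: S_def dist_real_def)+
  have inD: "(s, z) \<in> D" if "s \<in> S" "z \<in> {b..x}" for s z
    using S[OF that(1)] that(2) by (auto simp: D_def)
  have tS: "t \<in> S" using \<open>e > 0\<close> by (simp add: S_def)
  have "((\<lambda>s. integral (cbox b x) (\<lambda>z. exp (a * z) * V s z)) has_real_derivative
      integral (cbox b x) (\<lambda>z. exp (a * z) * D_t V t z)) (at t within S)"
  proof (rule leibniz_rule_field_derivative)
    fix s z assume "s \<in> S" "z \<in> cbox b x"
    then show "((\<lambda>s. exp (a * z) * V s z) has_real_derivative exp (a * z) * D_t V s z) (at s within S)"
      using has_field_derivative_at_within[OF V_derivs(1)[OF inD]] by (intro DERIV_cmult) auto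
  next
    fix s assume "s \<in> S"
    then show "(\<lambda>z. exp (a * z) * V s z) integrable_on cbox b x"
      by (intro integrable_continuous continuous_intros V_cont_x S)
  next
    have "continuous_on (S \<times> cbox b x) (\<lambda>p. D_t V (fst p) (snd p))"
      using continuous_on_subset[OF V_deriv_conts(1)[unfolded case_prod_unfold]] inD
      by (metis (no_types, lifting) box_real(2) mem_Sigma_iff subrelI)
    then show "continuous_on (S \<times> cbox b x) (\<lambda>(s, z). exp (a * z) * D_t V s z)"
      unfolding case_prod_unfold by (intro continuous_intros)
  qed (use tS in \<open>auto simp: S_def\<close>)
  moreover have "((\<lambda>z. exp (a * z) * D_t V t z) has_integral
      flux t x - flux t b + (a\<^sup>2 / 2 + 1) * (I t x - I t b)) {b..x}"
  proof -
    have "((\<lambda>z. exp (a * z) * (D_xx V t z / 2 - a\<^sup>2 / 2 * V t z)) has_integral flux t x - flux t b) {b..x}"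
      using flux_deriv[OF inD[OF tS]] b(2)
      by (intro fundamental_theorem_of_calculus)
         (auto simp: has_real_derivative_iff_has_vector_derivative[symmetric] intro: has_field_derivative_at_within)
    moreover have "((\<lambda>z. exp (a * z) * V t z) has_integral I t x - I t b) {b..x}"
      using I_deriv_x[OF t] b(2)
      by (intro fundamental_theorem_of_calculus)
         (auto simp: has_real_derivative_iff_has_vector_derivative[symmetric] intro: has_field_derivative_at_within)
    ultimately have "((\<lambda>z. exp (a * z) * (D_xx V t z / 2 - a\<^sup>2 / 2 * V t z)
        + (a\<^sup>2 / 2 + 1) * (exp (a * z) * V t z)) has_integral
        flux t x - flux t b + (a\<^sup>2 / 2 + 1) * (I t x - I t b)) {b..x}"
      by (intro has_integral_add has_integral_mult_right)
    then show ?thesis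
    proof (rule has_integral_eq[rotated])
      fix z assume "z \<in> {b..x}"
      then have "D_t V t z = 1/2 * D_xx V t z + V t z"
        using t b by (intro pde) auto
      then show "exp (a * z) * (D_xx V t z / 2 - a\<^sup>2 / 2 * V t z) + (a\<^sup>2 / 2 + 1) * (exp (a * z) * V t z)
          = exp (a * z) * D_t V t z"
        by (simp add: algebra_simps)
    qed
  qed
  moreover have "at t within S = at t"
    using \<open>e > 0\<close> by (simp add: S_def at_within_Icc_at)
  ultimately have "((\<lambda>s. integral {b..x} (\<lambda>z. exp (a * z) * V s z)) has_real_derivative
      flux t x - flux t b + (a\<^sup>2 / 2 + 1) * (I t x - I t b)) (at t)"
    by (simp add: integral_unique)
  then show ?thesis
    by (rule has_field_derivative_transform_within_open[where S = "{0<..}"])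
       (auto simp: t exp_primitive_diff[OF a_pos V_measurable V_abs b(2), symmetric])
qed

section \<open>Behaviour close to the free boundary\<close>

text \<open>The sequential slope condition in filter form, which gives bounds on a full
  neighbourhood and composes with other limits.\<close>

lemma slope_tendsto:
  assumes "t > 0"
  shows "((\<lambda>(s, z). D_x V s z) \<longlongrightarrow> - \<beta>) (at (t, L t) within D)"
  unfolding tendsto_at_iff_sequentially
proof (intro allI impI)
  fix X assume X: "\<forall>i. X i \<in> D - {(t, L t)}" "X \<longlonglongrightarrow> (t, L t)"
  have "(\<lambda>n. D_x V (fst (X n)) (snd (X n))) \<longlonglongrightarrow> - \<beta>"
    using X tendsto_fst[OF X(2)] tendsto_snd[OF X(2)]
    by (intro slope[OF assms]) (auto simp: D_def case_prod_unfold)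
  then show "((\<lambda>(s, z). D_x V s z) \<circ> X) \<longlonglongrightarrow> - \<beta>"
    by (simp add: comp_def case_prod_unfold)
qed

text \<open>One \<open>y\<close> serves all times near \<open>t\<close>. The slope limit bounds the
  slopes by half of \<open>- \<beta>\<close>, and keeping \<open>L s\<close> below the midpoint of
  \<open>L t\<close> and \<open>y\<close> leaves an interval of definite width on which
  \<open>V\<close> must drop.\<close>

lemma boundary_strip:
  assumes t: "t > 0" and x: "L t < x"
  obtains y h where "0 < h" "h < t" "L t < y" "y < x"
    "\<And>s. \<bar>s - t\<bar> < h \<Longrightarrow> L s < (L t + y) / 2"
    "\<And>s z. \<bar>s - t\<bar> < h \<Longrightarrow> L s < z \<Longrightarrow> z \<le> y \<Longrightarrow> D_x V s z \<le> - (\<beta> / 2)"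
proof -
  have "\<forall>\<^sub>F p in at (t, L t) within D. (case p of (s, z) \<Rightarrow> D_x V s z) < - (\<beta> / 2)"
    using beta_pos by (intro order_tendstoD(2)[OF slope_tendsto[OF t]]) simp
  then obtain d where d: "d > 0"
    "\<And>s z. (s, z) \<in> D \<Longrightarrow> (s, z) \<noteq> (t, L t) \<Longrightarrow> dist (s, z) (t, L t) < d \<Longrightarrow> D_x V s z < - (\<beta> / 2)"
    unfolding eventually_at by fastforce
  \<comment> \<open>The first bound keeps space displacements within \<open>d / 2\<close>, the
    second keeps \<open>y\<close> below \<open>x\<close>.\<close>
  define y where "y = min (L t + d / 2) ((L t + x) / 2)"
  have y: "L t < y" "y < x" "y \<le> L t + d / 2"
    using x d by (auto simp: y_def min_def)
  have "\<forall>\<^sub>F s in at t. L s < (L t + y) / 2 \<and> L t - d / 2 < L s"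
    using y d by (intro eventually_conj order_tendstoD[OF L_isCont[OF t, unfolded isCont_def]]) auto
  then obtain e where e: "e > 0" "\<And>s. s \<noteq> t \<Longrightarrow> dist s t < e \<Longrightarrow> L s < (L t + y) / 2 \<and> L t - d / 2 < L s"
    unfolding eventually_at by auto
  have near: "L s < (L t + y) / 2" "L t - d / 2 < L s" if "\<bar>s - t\<bar> < e" for s
    using e(2)[of s] that y d by (cases "s = t"; auto simp: dist_real_def)+
  show thesis
  \<comment> \<open>Time displacements below \<open>d / 2\<close> complement the space displacements
    within \<open>d / 2\<close>; the bound \<open>t / 2\<close> keeps the times positive.\<close>
  proof (rule that[of "min (min e (d / 2)) (t / 2)" y])
    fix s z assume s: "\<bar>s - t\<bar> < min (min e (d / 2)) (t / 2)" and z: "L s < z" "z \<le> y"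
    have "dist (s, z) (t, L t) \<le> \<bar>s - t\<bar> + \<bar>z - L t\<bar>"
      using sqrt_sum_squares_le_sum_abs[of "s - t" "z - L t"] by (simp add: dist_Pair_Pair dist_real_def)
    also have "\<dots> < d"
      using s z near(2)[of s] y by (auto simp: abs_if split: if_splits)
    finally have "dist (s, z) (t, L t) < d" .
    moreover have "s > 0" using s by (auto simp: abs_if split: if_splits)
    ultimately show "D_x V s z \<le> - (\<beta> / 2)"
      using d(2)[of s z] z by (fastforce simp: D_def)
  qed (use y t d e near in auto)
qed

lemma boundary_decrease:
  assumes s: "s > 0" and z: "L s \<le> z1" "z1 \<le> z2" "z2 \<le> y"
    and strip: "\<And>z. L s < z \<Longrightarrow> z \<le> y \<Longrightarrow> D_x V s z \<le> - (\<beta> / 2)"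
  shows "\<beta> / 2 * (z2 - z1) \<le> V s z1 - V s z2"
proof (cases "z1 = z2")
  case False
  then have "z1 < z2" using z by simp
  moreover have "V s differentiable (at z)" if "z1 < z" for z
    using V_derivs(2)[of s z] that s z by (auto simp: D_def real_differentiable_def)
  ultimately obtain l c where c: "z1 < c" "c < z2" "DERIV (V s) c :> l" "V s z2 - V s z1 = (z2 - z1) * l"
    using MVT[OF _ V_cont_x[OF s], of z1 z2] by blast
  then have "l = D_x V s c"
    using V_derivs(2)[of s c] s z by (intro DERIV_unique[OF c(3)]) (auto simp: D_def)
  then have "l \<le> - (\<beta> / 2)"
    using strip c z by simp
  from mult_left_mono[OF this, of "z2 - z1"] c z show ?thesis
    by (simp add: algebra_simps)
qed simp

text \<open>
  An envelope argument: the integrand vanishes at the lower end point \<open>l s\<close>, so moving that end point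
  contributes only at second order and \<open>l\<close> itself need not be differentiated.
\<close>
lemma level_time_derivative:
  assumes t: "t > 0" and "y < x" and "0 < h"
    and strip: "\<And>s z. \<bar>s - t\<bar> < h \<Longrightarrow> L s < z \<Longrightarrow> z \<le> y \<Longrightarrow> D_x V s z \<le> - (\<beta> / 2)"
    and level: "\<And>s. \<bar>s - t\<bar> < h \<Longrightarrow> s > 0 \<and> L s < l s \<and> l s \<le> y \<and> V s (l s) = v"
  shows "((\<lambda>s. I s x - I s (l s) - v * (exp (a * x) - exp (a * l s)) / a) has_real_derivative
      flux t x - flux t (l t) + (a\<^sup>2 / 2 + 1) * (I t x - I t (l t))) (at t)"
proof -
  define b where "b = l t"
  have b: "L t < b" "b \<le> y" "V t b = v"
    using level[of t] \<open>0 < h\<close> by (auto simp: b_def)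
  \<comment> \<open>The error made when the moving end point \<open>l s\<close> is replaced by the
    fixed point \<open>b = l t\<close>.\<close>
  define r where "r s = (I s b - v * exp (a * b) / a) - (I s (l s) - v * exp (a * l s) / a)" for s
  have "(r has_real_derivative 0) (at t)"
  proof (rule has_real_derivative_zero_if_quadratic_bound)
    show "((\<lambda>s. V s b) has_real_derivative D_t V t b) (at t)"
      using t b by (intro V_derivs) (simp add: D_def)
    show "r t = 0"
      by (simp add: r_def b_def)
    have "\<forall>\<^sub>F s in at t. L s < b"
      by (rule order_tendstoD(2)[OF L_isCont[OF t, unfolded isCont_def] b(1)])
    moreover have "\<forall>\<^sub>F s in at t. \<bar>s - t\<bar> < h"
      unfolding eventually_at using \<open>0 < h\<close> by (auto simp: dist_real_def)
    ultimately show "\<forall>\<^sub>F s in at t. \<bar>r s\<bar> \<le> (2 / \<beta> * exp (a * y)) * (V s b - V t b)\<^sup>2"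
    proof eventually_elim
      case (elim s)
      note s = level[OF elim(2)]
      define S where "S = {min b (l s)..max b (l s)}"
      have dec: "\<beta> / 2 * (z2 - z1) \<le> V s z1 - V s z2" if "L s \<le> z1" "z1 \<le> z2" "z2 \<le> y" for z1 z2
        using s by (intro boundary_decrease[OF _ that] strip elim) auto
      have anti: "V s z2 \<le> V s z1" if "L s \<le> z1" "z1 \<le> z2" "z2 \<le> y" for z1 z2
      proof -
        have "0 \<le> \<beta> / 2 * (z2 - z1)"
          using that beta_pos by simp
        with dec[OF that] show ?thesis by linarith
      qed
      \<comment> \<open>The space derivative is \<open>exp (a * z) * (V s z - v)\<close>. Between
        \<open>b\<close> and \<open>l s\<close> monotonicity of \<open>V s\<close> and
        \<open>V s (l s) = v\<close> bound the second factor by its size at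
        \<open>b\<close>.\<close>
      have "norm ((I s b - v * exp (a * b) / a) - (I s (l s) - v * exp (a * l s) / a))
          \<le> (exp (a * y) * \<bar>V s b - v\<bar>) * norm (b - l s)"
      proof (rule field_differentiable_bound[where S = S])
        fix z assume z: "z \<in> S"
        show "((\<lambda>z. I s z - v * exp (a * z) / a) has_real_derivative exp (a * z) * (V s z - v)) (at z within S)"
          using s a_pos
          by (auto intro!: derivative_eq_intros has_field_derivative_at_within[OF I_deriv_x]
                simp: field_simps)
        have "\<bar>V s z - v\<bar> \<le> \<bar>V s b - v\<bar>"
        proof (cases "b \<le> l s")
          case True
          with anti[of z "l s"] anti[of b z] z s b elim show ?thesis
            by (simp add: S_def)
        next
          case False
          with anti[of "l s" z] anti[of z b] z s b elim show ?thesis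
            by (simp add: S_def)
        qed
        moreover have "z \<le> y"
          using z s b by (auto simp: S_def)
        ultimately show "norm (exp (a * z) * (V s z - v)) \<le> exp (a * y) * \<bar>V s b - v\<bar>"
          unfolding real_norm_def abs_mult by (intro mult_mono) (use a_pos in auto)
      qed (auto simp: S_def)
      \<comment> \<open>The slope bound converts the difference of values into a distance; this
        supplies the second factor of the quadratic bound.\<close>
      moreover have "norm (b - l s) \<le> 2 / \<beta> * \<bar>V s b - v\<bar>"
      proof (cases "b \<le> l s")
        case True
        with dec[of b "l s"] s b elim have "\<beta> / 2 * (l s - b) \<le> V s b - v"
          by simp
        then have "\<beta> / 2 * (l s - b) \<le> \<bar>V s b - v\<bar>"
          using abs_ge_self order_trans by blast
        with True beta_pos show ?thesis
          by (simp add: field_simps)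
      next
        case False
        with dec[of "l s" b] s b elim have "\<beta> / 2 * (b - l s) \<le> - (V s b - v)"
          by simp
        then have "\<beta> / 2 * (b - l s) \<le> \<bar>V s b - v\<bar>"
          using abs_ge_minus_self order_trans by blast
        with False beta_pos show ?thesis
          by (simp add: field_simps)
      qed
      ultimately have "\<bar>r s\<bar> \<le> (exp (a * y) * \<bar>V s b - v\<bar>) * (2 / \<beta> * \<bar>V s b - v\<bar>)"
        unfolding r_def real_norm_def by (meson mult_left_mono order_trans abs_ge_zero exp_ge_zero mult_nonneg_nonneg)
      also have "\<dots> = (2 / \<beta> * exp (a * y)) * \<bar>V s b - v\<bar>\<^sup>2"
        by (simp add: power2_eq_square)
      finally show ?case
        using b by simp
    qed
  qed
  moreover have "((\<lambda>s. (I s x - I s b) - v * (exp (a * x) - exp (a * b)) / a) has_real_derivative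
      flux t x - flux t b + (a\<^sup>2 / 2 + 1) * (I t x - I t b) - 0) (at t)"
    using b \<open>y < x\<close> by (intro DERIV_diff interior_time_derivative t DERIV_const) auto
  ultimately have "((\<lambda>s. ((I s x - I s b) - v * (exp (a * x) - exp (a * b)) / a) + r s) has_real_derivative
      flux t x - flux t b + (a\<^sup>2 / 2 + 1) * (I t x - I t b) - 0 + 0) (at t)"
    by (intro DERIV_add)
  then show ?thesis
    by (simp add: r_def b_def diff_divide_distrib right_diff_distrib algebra_simps)
qed

section \<open>Time derivative up to the free boundary\<close>

text \<open>An exchange of limits. The cut-off integrals \<open>M e\<close> have derivatives
  \<open>R e\<close>, and \<open>R e t\<close> tends to \<open>R0\<close> jointly as
  \<open>t\<close> tends to \<open>t0\<close> and \<open>e\<close> decreases to 0. The mean value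
  theorem for fixed \<open>e\<close> gives increments close to \<open>R0 * (t - t0)\<close>
  uniformly in \<open>e\<close>, and this bound survives the limit in \<open>e\<close>.\<close>

lemma time_derivative:
  assumes t0: "t0 > 0" and x: "L t0 < x"
  shows "((\<lambda>t. I t x) has_real_derivative flux t0 x + (a\<^sup>2 / 2 + 1) * I t0 x) (at t0)"
proof -
  obtain y h where h: "0 < h" "h < t0" and y: "L t0 < y" "y < x"
    and near: "\<And>s. \<bar>s - t0\<bar> < h \<Longrightarrow> L s < (L t0 + y) / 2"
    and strip: "\<And>s z. \<bar>s - t0\<bar> < h \<Longrightarrow> L s < z \<Longrightarrow> z \<le> y \<Longrightarrow> D_x V s z \<le> - (\<beta> / 2)"
    using boundary_strip[OF t0 x] by metis
  \<comment> \<open>Slope bound \<open>\<beta> / 2\<close> times half the width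
    \<open>y - L t0\<close>: for every time within \<open>h\<close> of \<open>t0\<close>,
    \<open>V\<close> has dropped to at most \<open>1 - k\<close> at \<open>y\<close>, so all levels
    \<open>1 - e\<close> with \<open>e \<le> k\<close> are attained.\<close>
  define k where "k = \<beta> / 4 * (y - L t0)"
  have k: "k > 0" using beta_pos y by (simp add: k_def)
  have pos: "t > 0" if "\<bar>t - t0\<bar> < h" for t
    using that h by (auto simp: abs_if split: if_splits)
  have dec: "\<beta> / 2 * (z - L t) \<le> 1 - V t z" if "\<bar>t - t0\<bar> < h" "L t \<le> z" "z \<le> y" for t z
    using boundary_decrease[OF pos[OF that(1)] order_refl that(2,3) strip[OF that(1)]]
      V_left[OF pos[OF that(1)] order_refl] by simp

  \<comment> \<open>\<open>L\<close> is only continuous, so the domain is cut off at the level curve \<open>V = 1 - e\<close> instead; the error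
    estimates are uniform for \<open>t\<close> near \<open>t0\<close> and survive the limit \<open>e \<longrightarrow> 0\<close>.\<close>
  define l where "l e t = (SOME z. L t < z \<and> z \<le> y \<and> V t z = 1 - e)" for e t
  have l: "L t < l e t" "l e t \<le> y" "V t (l e t) = 1 - e" "l e t \<le> L t + 2 / \<beta> * e"
    if e: "0 < e" "e \<le> k" and t: "\<bar>t - t0\<bar> < h" for e t
  proof -
    have Ly: "L t \<le> y" using near[OF t] y by simp
    have "\<beta> / 2 * ((y - L t0) / 2) \<le> \<beta> / 2 * (y - L t)"
      using near[OF t] beta_pos by (intro mult_left_mono) auto
    with dec[OF t Ly order_refl] have "V t y \<le> 1 - e"
      using e by (simp add: k_def)
    moreover have "1 - e \<le> V t (L t)"
      using V_left[OF pos[OF t] order_refl] e by simp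
    ultimately obtain z where z: "L t \<le> z" "z \<le> y" "V t z = 1 - e"
      using IVT2'[of "V t" y "1 - e" "L t"] Ly V_cont_x[OF pos[OF t]] by blast
    moreover have "z \<noteq> L t"
      using z e V_left[OF pos[OF t] order_refl] by auto
    ultimately have "\<exists>z. L t < z \<and> z \<le> y \<and> V t z = 1 - e"
      by (intro exI[of _ z]) auto
    from someI_ex[OF this] show *: "L t < l e t" "l e t \<le> y" "V t (l e t) = 1 - e"
      unfolding l_def by auto
    show "l e t \<le> L t + 2 / \<beta> * e"
      using dec[OF t, of "l e t"] * beta_pos by (simp add: field_simps)
  qed

  define M where "M e t = I t x - I t (l e t) - (1 - e) * (exp (a * x) - exp (a * l e t)) / a" for e t
  define R where "R e t = flux t x - flux t (l e t) + (a\<^sup>2 / 2 + 1) * (I t x - I t (l e t))" for e t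
  define R0 where "R0 = flux t0 x + (a\<^sup>2 / 2 + 1) * I t0 x"
  have M_deriv: "(M e has_real_derivative R e t) (at t)" if e: "0 < e" "e \<le> k" and t: "\<bar>t - t0\<bar> < h" for e t
    unfolding M_def[abs_def] R_def
  \<comment> \<open>The reduced radius keeps all times within \<open>h\<close> of \<open>t0\<close>,
    where the strip bounds hold.\<close>
  proof (rule level_time_derivative[where y = y and h = "h - \<bar>t - t0\<bar>"])
    fix s assume "\<bar>s - t\<bar> < h - \<bar>t - t0\<bar>"
    then have s: "\<bar>s - t0\<bar> < h" by linarith
    show "0 < s \<and> L s < l e s \<and> l e s \<le> y \<and> V s (l e s) = 1 - e"
      using l[OF e s] pos[OF s] by simp
    show "D_x V s z \<le> - (\<beta> / 2)" if "L s < z" "z \<le> y" for z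
      using strip[OF s that] .
  qed (use t y pos[OF t] in auto)

  \<comment> \<open>The filter \<open>nhds t0\<close> includes \<open>t0\<close> itself: the
    derivative bound is later applied on a full ball around \<open>t0\<close>.\<close>
  let ?F = "nhds t0 \<times>\<^sub>F at_right (0 :: real)"
  have evk: "\<forall>\<^sub>F e in at_right 0. 0 < e \<and> e \<le> k"
    using eventually_at_right_real[OF k] by (rule eventually_mono) auto
  have fst_ev: "\<forall>\<^sub>F p in ?F. P (fst p)" if "\<forall>\<^sub>F t in nhds t0. P t" for P
    using that unfolding eventually_prod_filter by (intro exI[of _ P] exI[of _ "\<lambda>_. True"]) auto
  have snd_ev: "\<forall>\<^sub>F p in ?F. P (snd p)" if "\<forall>\<^sub>F e in at_right 0. P e" for P
    using that unfolding eventually_prod_filter by (intro exI[of _ "\<lambda>_. True"] exI[of _ P]) auto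
  have "\<forall>\<^sub>F t in nhds t0. \<bar>t - t0\<bar> < h"
    unfolding eventually_nhds_metric using h by (auto simp: dist_real_def)
  from eventually_conj[OF fst_ev[OF this] snd_ev[OF evk]]
  have ev: "\<forall>\<^sub>F p in ?F. \<bar>fst p - t0\<bar> < h \<and> 0 < snd p \<and> snd p \<le> k" .
  have fst_lim: "(fst \<longlongrightarrow> t0) ?F"
    unfolding filterlim_iff using fst_ev by blast
  have snd_lim: "(snd \<longlongrightarrow> 0) ?F"
    unfolding filterlim_iff using snd_ev filter_leD[OF at_within_le_nhds] by blast
  have L_lim: "((\<lambda>p. L (fst p)) \<longlongrightarrow> L t0) ?F"
    by (rule isCont_tendsto_compose[OF L_isCont[OF t0] fst_lim])
  have l_lim: "((\<lambda>p. l (snd p) (fst p)) \<longlongrightarrow> L t0) ?F"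
  proof (rule real_tendsto_sandwich[OF _ _ L_lim])
    have "((\<lambda>p. L (fst p) + 2 / \<beta> * snd p) \<longlongrightarrow> L t0 + 2 / \<beta> * 0) ?F"
      by (intro tendsto_intros L_lim snd_lim)
    then show "((\<lambda>p. L (fst p) + 2 / \<beta> * snd p) \<longlongrightarrow> L t0) ?F" by simp
    show "\<forall>\<^sub>F p in ?F. L (fst p) \<le> l (snd p) (fst p)"
      using ev by eventually_elim (auto intro: less_imp_le[OF l(1)])
    show "\<forall>\<^sub>F p in ?F. l (snd p) (fst p) \<le> L (fst p) + 2 / \<beta> * snd p"
      using ev by eventually_elim (rule l(4), auto)
  qed
  have slope_lim: "((\<lambda>p. D_x V (fst p) (l (snd p) (fst p))) \<longlongrightarrow> - \<beta>) ?F"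
  proof -
    have "filterlim (\<lambda>p. (fst p, l (snd p) (fst p))) (at (t0, L t0) within D) ?F"
      unfolding filterlim_at
    proof
      show "((\<lambda>p. (fst p, l (snd p) (fst p))) \<longlongrightarrow> (t0, L t0)) ?F"
        by (intro tendsto_Pair fst_lim l_lim)
      show "\<forall>\<^sub>F p in ?F. (fst p, l (snd p) (fst p)) \<in> D \<and> (fst p, l (snd p) (fst p)) \<noteq> (t0, L t0)"
        using ev
      proof eventually_elim
        case (elim p)
        with l(1)[of "snd p" "fst p"] pos[of "fst p"] show ?case by (auto simp: D_def)
      qed
    qed
    from filterlim_compose[OF slope_tendsto[OF t0] this] show ?thesis by simp
  qed
  have "(t0, x) \<in> D" using t0 x by (simp add: D_def)
  then have "isCont (\<lambda>(t, z). D_x V t z) (t0, x)"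
    using V_deriv_conts(2) open_D by (simp add: continuous_on_eq_continuous_at)
  from isCont_tendsto_compose[OF this tendsto_Pair[OF fst_lim tendsto_const]]
  have Dx_lim: "((\<lambda>p. D_x V (fst p) x) \<longlongrightarrow> D_x V t0 x) ?F" by simp
  have "((\<lambda>p. R (snd p) (fst p)) \<longlongrightarrow> flux t0 x - exp (a * L t0) * (- \<beta> / 2 - a / 2 * V t0 (L t0))
      + (a\<^sup>2 / 2 + 1) * (I t0 x - I t0 (L t0))) ?F"
    unfolding R_def flux_def
    by (intro tendsto_add tendsto_diff tendsto_mult tendsto_divide tendsto_exp tendsto_const
        slope_lim Dx_lim l_lim V_tendsto[OF t0 fst_lim] I_tendsto[OF t0 fst_lim]) auto
  \<comment> \<open>At \<open>L t0\<close> one has \<open>V = 1\<close> and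
    \<open>I = exp (a * L t0) / a\<close>. The boundary terms add up to
    \<open>exp (a * L t0) * (\<beta> / 2 - 1 / a)\<close>, which vanishes.\<close>
  moreover have "flux t0 x - exp (a * L t0) * (- \<beta> / 2 - a / 2 * V t0 (L t0))
      + (a\<^sup>2 / 2 + 1) * (I t0 x - I t0 (L t0)) = R0"
  proof -
    have "\<beta> = 2 / a" using a_beta a_pos by (simp add: field_simps)
    then show ?thesis
      using a_pos by (simp add: R0_def I_left[OF t0] V_left[OF t0] field_simps power2_eq_square)
  qed
  ultimately have R_lim: "((\<lambda>p. R (snd p) (fst p)) \<longlongrightarrow> R0) ?F" by simp

  \<comment> \<open>The limit differs from \<open>I t x\<close> only by
    \<open>exp (a * x) / a\<close>, which does not depend on \<open>t\<close> and drops out of the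
    increments.\<close>
  have M_lim: "((\<lambda>e. M e t) \<longlongrightarrow> I t x - exp (a * x) / a) (at_right 0)" if t: "\<bar>t - t0\<bar> < h" for t
  proof -
    have l_lim: "((\<lambda>e. l e t) \<longlongrightarrow> L t) (at_right 0)"
    proof (rule real_tendsto_sandwich[OF _ _ tendsto_const])
      have "((\<lambda>e. L t + 2 / \<beta> * e) \<longlongrightarrow> L t + 2 / \<beta> * 0) (at_right 0)"
        by (intro tendsto_intros)
      then show "((\<lambda>e. L t + 2 / \<beta> * e) \<longlongrightarrow> L t) (at_right 0)" by simp
      show "\<forall>\<^sub>F e in at_right 0. L t \<le> l e t"
        using evk by eventually_elim (auto intro: less_imp_le[OF l(1)] t)
      show "\<forall>\<^sub>F e in at_right 0. l e t \<le> L t + 2 / \<beta> * e"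
        using evk by eventually_elim (rule l(4), auto intro: t)
    qed
    have "((\<lambda>e. M e t) \<longlongrightarrow> I t x - I t (L t) - (1 - 0) * (exp (a * x) - exp (a * L t)) / a) (at_right 0)"
      unfolding M_def using a_pos
      by (intro tendsto_intros l_lim I_tendsto pos[OF t]) auto
    then show ?thesis
      using I_left[OF pos[OF t], of "L t"] by (simp add: diff_divide_distrib)
  qed

  show ?thesis
    unfolding has_field_derivative_def has_derivative_at_alt R0_def[symmetric]
  proof (intro conjI allI impI)
    show "bounded_linear ((*) R0)" by (rule bounded_linear_mult_right)
    fix \<eta> :: real assume "\<eta> > 0"
    then have "\<forall>\<^sub>F p in ?F. dist (R (snd p) (fst p)) R0 < \<eta>"
      by (rule tendstoD[OF R_lim])
    then obtain P Q where PQ: "eventually P (nhds t0)" "eventually Q (at_right 0)"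
        "\<And>t e. P t \<Longrightarrow> Q e \<Longrightarrow> dist (R e t) R0 < \<eta>"
      unfolding eventually_prod_filter by auto
    obtain d where d: "d > 0" "\<And>t. dist t t0 < d \<Longrightarrow> P t"
      using PQ(1) unfolding eventually_nhds_metric by auto
    show "\<exists>d>0. \<forall>t. norm (t - t0) < d \<longrightarrow>
        norm (I t x - I t0 x - R0 * (t - t0)) \<le> \<eta> * norm (t - t0)"
    proof (intro exI[of _ "min d h"] conjI allI impI)
      show "min d h > 0" using d h by simp
      fix t assume t: "norm (t - t0) < min d h"
      have "((\<lambda>e. \<bar>M e t - M e t0 - R0 * (t - t0)\<bar>) \<longlongrightarrow>
          \<bar>(I t x - exp (a * x) / a) - (I t0 x - exp (a * x) / a) - R0 * (t - t0)\<bar>) (at_right 0)"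
        using t h by (intro tendsto_rabs tendsto_diff M_lim tendsto_const) auto
      then have lim: "((\<lambda>e. \<bar>M e t - M e t0 - R0 * (t - t0)\<bar>) \<longlongrightarrow> \<bar>I t x - I t0 x - R0 * (t - t0)\<bar>) (at_right 0)"
        by simp
      have "\<forall>\<^sub>F e in at_right 0. \<bar>M e t - M e t0 - R0 * (t - t0)\<bar> \<le> \<eta> * norm (t - t0)"
        using evk PQ(2)
      proof eventually_elim
        case (elim e)
        \<comment> \<open>Subtracting the linear function \<open>R0 * t\<close> makes the derivative
          at most \<open>\<eta>\<close> in size on the ball, with a radius independent of
          \<open>e\<close>.\<close>
        have "norm ((M e t - R0 * t) - (M e t0 - R0 * t0)) \<le> \<eta> * norm (t - t0)"
        proof (rule field_differentiable_bound[where S = "ball t0 (min d h)"])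
          fix s assume "s \<in> ball t0 (min d h)"
          then have s: "\<bar>s - t0\<bar> < h" "dist s t0 < d" by (auto simp: dist_real_def)
          show "((\<lambda>t. M e t - R0 * t) has_real_derivative R e s - R0) (at s within ball t0 (min d h))"
            using elim by (auto intro!: derivative_eq_intros has_field_derivative_at_within[OF M_deriv] s)
          show "norm (R e s - R0) \<le> \<eta>"
            using less_imp_le[OF PQ(3)[OF d(2)[OF s(2)] elim(2)]] by (simp add: dist_real_def)
        qed (use t d h in \<open>auto simp: dist_real_def\<close>)
        then show ?case by (simp add: algebra_simps)
      qed
      from tendsto_upperbound[OF lim this] show "norm (I t x - I t0 x - R0 * (t - t0)) \<le> \<eta> * norm (t - t0)"
        by simp
    qed
  qed
qed

end

section \<open>The transformed solution\<close>

theorem proposition7p8: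
  fixes \<beta> :: real
    and V U :: "real \<Rightarrow> real \<Rightarrow> real"
    and L V0 U0 :: "real \<Rightarrow> real"
  assumes "\<beta> > 0"
    and "admissible V0"
    and "classical_solution_FBP_beta \<beta> V0 V L"
    and "\<And>t x. t > 0 \<Longrightarrow>
           U t x = 2 / \<beta> * exp (- (2 / \<beta>) * x) * (LINT z:{..x}|lborel. exp (2 / \<beta> * z) * V t z)"
    and "\<And>x. U0 x = 2 / \<beta> * exp (- (2 / \<beta>) * x) * (LINT z:{..x}|lborel. exp (2 / \<beta> * z) * V0 z)"
  shows "classical_solution_FBP U0 U L"
proof -
  define a where "a = 2 / \<beta>"
  have a: "a > 0" using assms(1) by (simp add: a_def)
  interpret fbp_beta a \<beta> V L
    using assms(1,3) unfolding classical_solution_FBP_beta_def FBP_beta_def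
    by unfold_locales (auto simp: a_def)
  have U: "U t x = a * exp (- a * x) * I t x" if "t > 0" for t x
    using assms(4)[OF that] by (simp add: a_def exp_primitive_def)
  have U0: "U0 x = a * exp (- a * x) * exp_primitive a V0 x" for x
    using assms(5) by (simp add: a_def exp_primitive_def)
  have cancel: "a * exp (- a * x) * (exp (a * x) / a * y) = y" for x y
    using a by (simp add: exp_minus field_simps)
  have U_kernel: "U t x = (LINT z|lborel. exp_kernel a z * V t (x + z))" if "t > 0" for t x
    unfolding U[OF that] exp_primitive_eq[OF a] cancel ..
  have U0_kernel: "U0 x = (LINT z|lborel. exp_kernel a z * V0 (x + z))" for x
    unfolding U0 exp_primitive_eq[OF a] cancel ..

  have U_bounds: "U t x \<in> {0..1}" if "t > 0" for t x
    unfolding U_kernel[OF that] by (intro integral_exp_kernel_bounds[OF a] V_measurable V_bounds that)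
  have U_left: "U t x = 1" if "t > 0" "x \<le> L t" for t x
    using cancel[of x 1] by (simp add: U that I_left)
  have U_cont: "continuous_on ({0<..} \<times> UNIV) (\<lambda>(t, x). U t x)"
  proof -
    have "continuous_on ({0<..} \<times> UNIV) (\<lambda>p. a * exp (- a * snd p) * I (fst p) (snd p))"
      using I_cont unfolding case_prod_unfold by (intro continuous_on_mult continuous_intros)
    then show ?thesis
      by (rule continuous_on_eq) (auto simp: U)
  qed
  \<comment> \<open>This holds at every \<open>x\<close>, in particular at \<open>L t\<close>, where
    \<open>U\<close> and \<open>V\<close> both equal 1; the two-sided boundary condition
    follows.\<close>
  have U_x: "(U t has_real_derivative a * (V t x - U t x)) (at x)" if t: "t > 0" for t x
  proof -
    have "((\<lambda>x. a * exp (- a * x) * I t x) has_real_derivative a * (V t x - U t x)) (at x)"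
      by (rule derivative_eq_intros I_deriv_x[OF t] refl)+
         (simp add: U[OF t] exp_minus field_simps)
    also have "(\<lambda>x. a * exp (- a * x) * I t x) = U t"
      using U[OF t] by auto
    finally show ?thesis .
  qed
  have D_x_U: "D_x U t = (\<lambda>x. a * (V t x - U t x))" if "t > 0" for t
    unfolding D_x_def using DERIV_imp_deriv[OF U_x[OF that]] by auto
  have U_xx: "(D_x U t has_real_derivative a * (D_x V t x - a * (V t x - U t x))) (at x)" if "(t, x) \<in> D" for t x
    using that unfolding D_iff
    by (subst D_x_U) (auto intro!: derivative_eq_intros U_x V_derivs simp: D_iff)
  have D_xx_U: "D_xx U t x = a * (D_x V t x - a * (V t x - U t x))" if "(t, x) \<in> D" for t x
    unfolding D_xx_def D_x_def[of "D_x U"] by (rule DERIV_imp_deriv[OF U_xx[OF that]])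
  \<comment> \<open>The terms \<open>a * (D_x V t x / 2 - a / 2 * V t x)\<close> from the flux and
    \<open>a\<^sup>2 / 2 * U t x\<close> form half of \<open>D_xx U\<close>; what remains is
    \<open>U\<close> itself.\<close>
  have U_t: "((\<lambda>s. U s x) has_real_derivative 1/2 * D_xx U t x + U t x) (at t)" if "(t, x) \<in> D" for t x
  proof -
    have t: "t > 0" "L t < x" using that by (auto simp: D_iff)
    have "((\<lambda>s. a * exp (- a * x) * I s x) has_real_derivative
        a * exp (- a * x) * (flux t x + (a\<^sup>2 / 2 + 1) * I t x)) (at t)"
      by (intro DERIV_cmult time_derivative t)
    also have "a * exp (- a * x) * (flux t x + (a\<^sup>2 / 2 + 1) * I t x) = 1/2 * D_xx U t x + U t x"
      unfolding D_xx_U[OF that] U[OF t(1)] flux_def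
      by (simp add: exp_minus field_simps power2_eq_square)
    finally show ?thesis
      by (rule has_field_derivative_transform_within_open[where S = "{0<..}"]) (auto simp: t U)
  qed
  have D_t_U: "D_t U t x = 1/2 * D_xx U t x + U t x" if "(t, x) \<in> D" for t x
    unfolding D_t_def by (rule DERIV_imp_deriv[OF U_t[OF that]])

  \<comment> \<open>Continuity of the derivatives of \<open>U\<close> follows from the formulas
    above, which express them on \<open>D\<close> through \<open>U\<close>, \<open>V\<close> and
    \<open>D_x V\<close>.\<close>
  have D_sub: "D \<subseteq> {0<..} \<times> UNIV" by (auto simp: D_def)
  have cU: "continuous_on D (\<lambda>p. U (fst p) (snd p))"
    using continuous_on_subset[OF U_cont D_sub] by (simp add: case_prod_unfold)
  have cV: "continuous_on D (\<lambda>p. V (fst p) (snd p))"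
    using continuous_on_subset[OF V_cont D_sub] by (simp add: case_prod_unfold)
  have cVx: "continuous_on D (\<lambda>p. D_x V (fst p) (snd p))"
    using V_deriv_conts(2) by (simp add: case_prod_unfold)
  have cUx: "continuous_on D (\<lambda>p. D_x U (fst p) (snd p))"
    by (rule continuous_on_eq[of _ "\<lambda>p. a * (V (fst p) (snd p) - U (fst p) (snd p))"])
       (auto intro!: continuous_intros cU cV simp: D_x_U D_iff)
  have cUxx: "continuous_on D (\<lambda>p. D_xx U (fst p) (snd p))"
    by (rule continuous_on_eq[of _ "\<lambda>p. a * (D_x V (fst p) (snd p) - a * (V (fst p) (snd p) - U (fst p) (snd p)))"])
       (auto intro!: continuous_intros cU cV cVx simp: D_xx_U)
  have cUt: "continuous_on D (\<lambda>p. D_t U (fst p) (snd p))"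
    by (rule continuous_on_eq[of _ "\<lambda>p. 1/2 * D_xx U (fst p) (snd p) + U (fst p) (snd p)"])
       (auto intro!: continuous_intros cU cUxx simp: D_t_U)
  have "(\<lambda>s. U s x) differentiable (at t)" "(\<lambda>y. U t y) differentiable (at x)"
      "(\<lambda>y. D_x U t y) differentiable (at x)" if "(t, x) \<in> D" for t x
    using U_t[OF that] U_x[of t x] U_xx[OF that] that
    unfolding real_differentiable_def D_iff by blast+
  then have "C12_on D U"
    unfolding C12_on_def case_prod_unfold
    using cU cUt cUx cUxx by auto
  then have "regular_pair U L"
    unfolding regular_pair_def using L_cont U_bounds U_cont by (simp add: D_def)
  moreover have "FBP U0 U L"
    unfolding FBP_def
  proof (intro conjI allI impI)
    fix t :: real assume t: "t > 0"
    show "D_t U t x = 1/2 * D_xx U t x + U t x" if "L t < x" for x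
      by (rule D_t_U) (simp add: D_def t that)
    show "U t x = 1" if "x \<le> L t" for x
      using U_left t that .
    show "((\<lambda>x. U t x) has_real_derivative 0) (at (L t))"
      using U_x[OF t, of "L t"] U_left[OF t order_refl] V_left[OF t order_refl] by simp
  next
    \<comment> \<open>Negation turns the non-increasing \<open>V0\<close> into an increasing
      function, to which Borel measurability of monotone functions applies.\<close>
    have "mono (\<lambda>x. - V0 x)"
      using assms(2) by (auto simp: admissible_def monotone_def)
    then have "(\<lambda>x. - (- V0 x)) \<in> borel_measurable borel"
      by (intro borel_measurable_uminus borel_measurable_mono)
    then have V0_m: "V0 \<in> borel_measurable borel" by simp
    have V0_bd: "V0 x \<in> {0..1}" for x
      using assms(2) unfolding admissible_def by blast
    show "L1_loc_initial U U0"
    proof (rule L1_loc_initial_exp_kernel)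
      show "L1_loc_initial V V0"
        using assms(3) by (simp add: classical_solution_FBP_beta_def FBP_beta_def)
    qed (fact a V_measurable V_bounds V0_m V0_bd U_kernel U0_kernel)+
  qed
  ultimately show ?thesis
    by (simp add: classical_solution_FBP_def)
qed

end
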